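(* For $\epsilon\in(0,1)$ let $\rho_\epsilon(x)=\frac1\epsilon$ for $x\in[0,\frac\epsilon2)\cup(1-\frac\epsilon2,1]$ and $\rho_\epsilon(x)=0$ otherwise. Consider on $\mathbb{T}\times\mathbb{R}$ the Vlasov-Poisson system $$\partial_tf(x,v,t)+v\,\partial_xf(x,v,t)-E(x,t)\,\partial_vf(x,v,t)=0,\qquad E(x,t)=\int_0^1K(x,y)\left[\rho_\epsilon(y)-\int_{-\infty}^\infty f(y,v,t)\,dv\right]dy.$$ Then there exists $\epsilon_0>0$ such that for all $\epsilon\in(0,\epsilon_0)$ a stationary (time-independent) solution of this system exists.
   Context: $\mathbb{T}=\mathbb{R}/\mathbb{Z}$, and the kernel is $K(x,y)=y-1$ for $0\le x<y$ and $K(x,y)=y$ for $y<x\le1$ (so that $\partial_xE=\rho_\epsilon-\int f\,dv$ and $\int_0^1E\,dx=0$). Standing assumption: $f$ is a nonnegative distribution function with $\int_{\mathbb{T}\times\mathbb{R}}f\,dx\,dv=1=\int_0^1\rho_\epsilon\,dx$. *)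

theory Defs
  imports "HOL-Analysis.Analysis"
begin

definition ion_density :: "real \<Rightarrow> real \<Rightarrow> real" where
  "ion_density \<epsilon> x = (if x \<in> {0..<\<epsilon>/2} \<union> {1 - \<epsilon>/2<..1} then 1 / \<epsilon> else 0)"

(* Used only for x, y in [0,1].  The value on the diagonal x = y (here y) is immaterial,
   since K x is only ever integrated over y. *)
definition K :: "real \<Rightarrow> real \<Rightarrow> real" where
  "K x y = (if x < y then y - 1 else y)"

definition electric_field ::
    "real \<Rightarrow> (real \<Rightarrow> real \<Rightarrow> real \<Rightarrow> real) \<Rightarrow> real \<Rightarrow> real \<Rightarrow> real" where
  "electric_field \<epsilon> f x t =
     (LINT y:{0..1}|lborel. K x y * (ion_density \<epsilon> y - (LINT v|lborel. f y v t)))"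

definition C1_phase_space_time :: "(real \<Rightarrow> real \<Rightarrow> real \<Rightarrow> real) \<Rightarrow> bool" where
  "C1_phase_space_time f \<longleftrightarrow>
     (\<forall>x v t. (\<lambda>y. f y v t) differentiable (at x) \<and>
              (\<lambda>w. f x w t) differentiable (at v) \<and>
              (\<lambda>s. f x v s) differentiable (at t)) \<and>
     continuous_on UNIV (\<lambda>(x, v, t). deriv (\<lambda>y. f y v t) x) \<and>
     continuous_on UNIV (\<lambda>(x, v, t). deriv (\<lambda>w. f x w t) v) \<and>
     continuous_on UNIV (\<lambda>(x, v, t). deriv (\<lambda>s. f x v s) t)"

(* f x v t is a distribution function on the torus times the line, with the torus R/Z
   encoded by 1-periodicity in x.  Integrals over the torus are integrals over [0,1]. *)
definition distribution_function :: "(real \<Rightarrow> real \<Rightarrow> real \<Rightarrow> real) \<Rightarrow> bool" where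
  "distribution_function f \<longleftrightarrow>
     (\<forall>x v t. f (x + 1) v t = f x v t) \<and>
     (\<forall>x v t. 0 \<le> f x v t) \<and>
     (\<forall>t. set_integrable lborel ({0..1} \<times> UNIV) (\<lambda>(x, v). f x v t) \<and>
          (LINT (x, v):{0..1} \<times> UNIV|lborel. f x v t) = 1)"

(* Classical (C^1, pointwise everywhere) solutions.  It is enough to impose the equation for x
   in [0,1], a fundamental domain of the torus; the formula for the field agrees at x = 0 and
   x = 1 because the total charge vanishes. *)
definition vlasov_poisson_solution :: "real \<Rightarrow> (real \<Rightarrow> real \<Rightarrow> real \<Rightarrow> real) \<Rightarrow> bool" where
  "vlasov_poisson_solution \<epsilon> f \<longleftrightarrow>
     distribution_function f \<and> C1_phase_space_time f \<and>
     (\<forall>x\<in>{0..1}. \<forall>v t.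
        deriv (\<lambda>s. f x v s) t + v * deriv (\<lambda>y. f y v t) x
          - electric_field \<epsilon> f x t * deriv (\<lambda>w. f x w t) v = 0)"

definition stationary :: "(real \<Rightarrow> real \<Rightarrow> real \<Rightarrow> real) \<Rightarrow> bool" where
  "stationary f \<longleftrightarrow> (\<forall>x v s t. f x v s = f x v t)"

end

theory Submission
  imports Defs
begin

text \<open>A function \<open>f(x,v) = F(v\<^sup>2/2 - n(x))\<close> of the energy solves the stationary Vlasov equation with field
  \<open>E = - n'\<close>, and the Poisson equation then reads \<open>n'' = \<integral>f dv - \<rho>\<close>. By scaling,
  \<open>\<integral>(w - v\<^sup>2/2)\<^sub>+ powr (3/2) dv = C w\<^sup>2\<close> for \<open>w \<ge> 0\<close>, so the \<open>C\<^sup>1\<close> profile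
  \<open>F(e) = ((m - e)\<^sub>+ powr (3/2) - (- m - e)\<^sub>+ powr (3/2)) / (4 C m)\<close> gives
  \<open>\<integral>f dv = ((n + m)\<^sup>2 - (n - m)\<^sup>2) / (4 m) = n\<close> as long as \<open>n \<ge> m\<close>. The problem is thereby reduced to the
  linear equation \<open>n'' = n - \<rho>\<close> on the circle, whose solution is explicit and bounded below
  by a positive constant \<open>m\<close>.\<close>

section \<open>Calculus of truncated functions and of the power 3/2\<close>

text \<open>Only \<open>s = 0\<close> is delicate. There the difference quotient of the truncated
  function is either zero or that of \<open>g\<close>, so its absolute value is dominated by a
  quantity tending to \<open>\<bar>g' 0\<bar> = 0\<close>.\<close>

lemma has_real_derivative_max_zero:
  fixes g g' :: "real \<Rightarrow> real"
  assumes g: "\<And>s. (g has_real_derivative g' s) (at s)" and g'0: "g' 0 = 0"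
  shows "((\<lambda>s. g (max 0 s)) has_real_derivative g' (max 0 s)) (at s)"
proof -
  consider "s < 0" | "s = 0" | "s > 0" by linarith
  then show ?thesis
  proof cases
    case 1
    have "((\<lambda>s. g 0) has_real_derivative g' (max 0 s)) (at s)"
      using 1 g'0 by (simp add: max_def)
    then show ?thesis
      by (rule has_field_derivative_transform_within_open[where S="{..<0}"]) (use 1 in auto)
  next
    case 3
    have "(g has_real_derivative g' (max 0 s)) (at s)"
      using 3 g by (simp add: max_def)
    then show ?thesis
      by (rule has_field_derivative_transform_within_open[where S="{0<..}"]) (use 3 in auto)
  next
    case 2
    have "((\<lambda>h. (g (0 + h) - g 0) / h) \<longlongrightarrow> 0) (at 0)"
      using g[of 0] g'0 unfolding DERIV_def by simp
    then have "((\<lambda>h. \<bar>(g (0 + h) - g 0) / h\<bar>) \<longlongrightarrow> 0) (at 0)"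
      by (rule tendsto_rabs_zero)
    then have "((\<lambda>h. (g (max 0 (0 + h)) - g (max 0 0)) / h) \<longlongrightarrow> 0) (at 0)"
      by (rule Lim_null_comparison[rotated]) (auto intro!: always_eventually simp: max_def divide_le_0_iff)
    then show ?thesis
      using 2 g'0 by (simp add: DERIV_def)
  qed
qed

text \<open>Since \<open>sqrt\<close> is extended as an odd function, \<open>s * sqrt s\<close> is
  the 3/2 power of \<open>\<bar>s\<bar>\<close> on the whole line. Having a derivative for every
  real \<open>s\<close> is what \<open>has_real_derivative_max_zero\<close> asks of
  \<open>g\<close>.\<close>

lemma has_real_derivative_mult_sqrt:
  "((\<lambda>s. s * sqrt s) has_real_derivative 3 / 2 * sqrt s) (at s)"
proof (cases "s = 0")
  case True
  have "(sqrt \<longlongrightarrow> sqrt 0) (at 0)"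
    by (intro tendsto_intros)
  then have "((\<lambda>h. ((0 + h) * sqrt (0 + h) - 0 * sqrt 0) / h) \<longlongrightarrow> 0) (at 0)"
    by (rule filterlim_cong[THEN iffD1, rotated -1]) (auto simp: eventually_at_filter)
  then show ?thesis
    using True by (simp add: DERIV_def)
next
  case False
  define D where "D = (if s > 0 then inverse (sqrt s) / 2 else - inverse (sqrt s) / 2)"
  have "(sqrt has_real_derivative D) (at s)"
    using False unfolding D_def by (intro DERIV_real_sqrt_generic) auto
  then have "((\<lambda>s. s * sqrt s) has_real_derivative s * D + 1 * sqrt s) (at s)"
    using DERIV_mult[OF DERIV_ident, of sqrt D s UNIV] by (simp add: algebra_simps)
  moreover have "s * D = sqrt s / 2"
  proof (cases "s > 0")
    case True
    then show ?thesis
      by (simp add: D_def divide_inverse [symmetric] real_div_sqrt)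
  next
    case False
    then have "- s / sqrt (- s) = sqrt (- s)"
      by (intro real_div_sqrt) simp
    with False show ?thesis
      by (simp add: D_def divide_inverse [symmetric] real_sqrt_minus)
  qed
  ultimately show ?thesis
    by simp
qed

text \<open>The truncated power 3/2 of the introductory comment, written as
  \<open>s * sqrt s\<close> after \<open>max 0\<close> so that the two preceding lemmas apply to
  it.\<close>

definition pow32 :: "real \<Rightarrow> real" where
  "pow32 s = max 0 s * sqrt (max 0 s)"

lemma has_real_derivative_pow32 [derivative_intros]:
  assumes "(g has_real_derivative D) (at x within S)"
  shows "((\<lambda>x. pow32 (g x)) has_real_derivative 3 / 2 * sqrt (max 0 (g x)) * D) (at x within S)"
proof -
  have "(pow32 has_real_derivative 3 / 2 * sqrt (max 0 s)) (at s)" for s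
    unfolding pow32_def [abs_def]
    by (rule has_real_derivative_max_zero[OF has_real_derivative_mult_sqrt]) simp
  from DERIV_chain2[OF this assms] show ?thesis .
qed

lemma continuous_on_pow32 [continuous_intros]:
  "continuous_on S g \<Longrightarrow> continuous_on S (\<lambda>x. pow32 (g x))"
  unfolding pow32_def by (intro continuous_intros)

lemma pow32_mono: "s \<le> t \<Longrightarrow> pow32 s \<le> pow32 t"
  unfolding pow32_def by (intro mult_mono) auto

lemma pow32_nonpos [simp]: "s \<le> 0 \<Longrightarrow> pow32 s = 0"
  by (simp add: pow32_def)

lemma pow32_mult: "0 \<le> c \<Longrightarrow> pow32 (c * s) = c * sqrt c * pow32 s"
  by (cases "s \<ge> 0") (simp_all add: pow32_def real_sqrt_mult mult_nonneg_nonpos)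

section \<open>Velocity integrals of the truncated power\<close>

text \<open>The constant \<open>C\<close> of the introductory comment.\<close>

definition kinetic_moment :: real where
  "kinetic_moment = (LINT v|lborel. pow32 (1 - v\<^sup>2 / 2))"

text \<open>Confines the velocity support: for such \<open>v\<close> the argument
  \<open>w - v\<^sup>2 / 2\<close> is nonpositive and \<open>pow32\<close> vanishes. As
  \<open>\<bar>v\<bar> \<ge> 1\<close>, the square dominates \<open>\<bar>v\<bar>\<close>
  itself.\<close>

lemma le_half_square:
  fixes v w :: real
  assumes "2 * \<bar>w\<bar> + 1 \<le> \<bar>v\<bar>"
  shows "w \<le> v\<^sup>2 / 2"
proof -
  have "\<bar>v\<bar> * 1 \<le> \<bar>v\<bar> * \<bar>v\<bar>"
    using assms by (intro mult_left_mono) auto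
  with assms have "2 * w \<le> \<bar>v\<bar> * \<bar>v\<bar>"
    by linarith
  then show ?thesis
    by (simp add: power2_eq_square)
qed

lemma integrable_pow32_kinetic: "integrable lborel (\<lambda>v. pow32 (w - v\<^sup>2 / 2))"
proof -
  define R where "R = 2 * \<bar>w\<bar> + 1"
  have "integrable lborel (\<lambda>v. indicator {-R..R} v *\<^sub>R pow32 (w - v\<^sup>2 / 2))"
    by (intro borel_integrable_compact continuous_intros) auto
  moreover have "indicator {-R..R} v *\<^sub>R pow32 (w - v\<^sup>2 / 2) = pow32 (w - v\<^sup>2 / 2)" for v
  proof (cases "v \<in> {-R..R}")
    case False
    then have "R \<le> \<bar>v\<bar>" by auto
    then show ?thesis using le_half_square[of w v] by (simp add: R_def)
  qed simp
  ultimately show ?thesis by (simp only:)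
qed

text \<open>On \<open>{-1..1}\<close> the integrand is at least \<open>pow32 (1/2)\<close>, and
  elsewhere it is nonnegative.\<close>

lemma kinetic_moment_pos: "kinetic_moment > 0"
proof -
  have "pow32 (1/2) * indicator {-1..1} v \<le> pow32 (1 - v\<^sup>2 / 2)" for v :: real
  proof (cases "v \<in> {-1..1}")
    case True
    then have "v\<^sup>2 \<le> 1" by (simp add: abs_le_iff abs_square_le_1)
    with True show ?thesis by (simp add: pow32_mono)
  next
    case False
    have "0 \<le> pow32 (1 - v\<^sup>2 / 2)" by (simp add: pow32_def)
    with False show ?thesis by simp
  qed
  then have "(LINT v|lborel. pow32 (1/2) * indicator {-1..1::real} v) \<le> kinetic_moment"
    unfolding kinetic_moment_def by (intro integral_mono integrable_pow32_kinetic) auto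
  then have "pow32 (1/2) * 2 \<le> kinetic_moment"
    by simp
  moreover have "0 < pow32 (1/2)"
    by (simp add: pow32_def)
  ultimately show ?thesis by linarith
qed

text \<open>Substituting \<open>sqrt w * v\<close> for \<open>v\<close> pulls a factor
  \<open>w * sqrt w\<close> out of the integrand and contributes the Jacobian \<open>sqrt w\<close>.
  The exponent 3/2 is chosen so that the product is exactly a square.\<close>

lemma integral_pow32_kinetic:
  assumes "0 \<le> w"
  shows "(LINT v|lborel. pow32 (w - v\<^sup>2 / 2)) = kinetic_moment * w\<^sup>2"
proof (cases "w = 0")
  case False
  with assms have w: "w > 0" by simp
  have "pow32 (w - (sqrt w * v)\<^sup>2 / 2) = w * sqrt w * pow32 (1 - v\<^sup>2 / 2)" for v
    using pow32_mult[of w "1 - v\<^sup>2 / 2"] w by (simp add: power_mult_distrib algebra_simps)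
  then have "(LINT v|lborel. pow32 (w - v\<^sup>2 / 2)) = sqrt w * (w * sqrt w * kinetic_moment)"
    using lborel_integral_real_affine[of "sqrt w" "\<lambda>v. pow32 (w - v\<^sup>2 / 2)" 0] w
    by (simp add: kinetic_moment_def)
  then show ?thesis
    using w by (simp add: power2_eq_square mult_ac)
qed simp

section \<open>Smooth periodic extension through the fractional part\<close>

text \<open>Agreement of \<open>g\<close> with its unit translate near the seam makes
  \<open>g (frac x)\<close> coincide with one fixed translate of \<open>g\<close> on an open
  interval reaching past both integers \<open>k\<close> and \<open>k + 1\<close>. Differentiability
  and continuity of the extension, even at integers, are then inherited from
  \<open>g\<close>.\<close>

lemma frac_periodization:
  fixes g :: "real \<Rightarrow> real" and k :: int and d x :: real
  assumes d: "0 < d" "d < 1" and per: "\<And>y. \<bar>y\<bar> < d \<Longrightarrow> g (y + 1) = g y"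
    and x: "x \<in> {k - d<..<k + 1 + d}"
  shows "g (x - k) = g (frac x)"
proof -
  consider "x < k" | "k \<le> x" "x < k + 1" | "k + 1 \<le> x" by linarith
  then show ?thesis
  proof cases
    case 1
    then have "\<lfloor>x\<rfloor> = k - 1" using x d by (intro floor_unique) auto
    then have "x - k + 1 = frac x" by (simp add: frac_def)
    then show ?thesis using per[of "x - k"] x d 1 by (simp add: abs_if)
  next
    case 2
    then have "\<lfloor>x\<rfloor> = k" by (intro floor_unique) auto
    then show ?thesis by (simp add: frac_def)
  next
    case 3
    then have "\<lfloor>x\<rfloor> = k + 1" using x d by (intro floor_unique) auto
    then show ?thesis using per[of "x - k - 1"] x d 3 by (simp add: frac_def algebra_simps)
  qed
qed

lemma frac_periodization_nhd:
  fixes d x :: real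
  assumes "0 < d"
  shows "x \<in> {\<lfloor>x\<rfloor> - d<..<\<lfloor>x\<rfloor> + 1 + d}"
  using assms floor_correct[of x] by (auto simp del: floor_correct) linarith+

lemma has_real_derivative_frac_periodization:
  fixes g g' :: "real \<Rightarrow> real"
  assumes d: "0 < d" "d < 1"
    and "\<And>y. \<bar>y\<bar> < d \<Longrightarrow> g (y + 1) = g y"
    and "\<And>y. (g has_real_derivative g' y) (at y)"
  shows "((\<lambda>x. g (frac x)) has_real_derivative g' (frac x)) (at x)"
proof (rule has_field_derivative_transform_within_open)
  show "((\<lambda>y. g (y - \<lfloor>x\<rfloor>)) has_real_derivative g' (frac x)) (at x)"
  proof -
    have "((\<lambda>y. y - \<lfloor>x\<rfloor>) has_real_derivative 1) (at x)"
      by (auto intro!: derivative_eq_intros)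
    from DERIV_chain2[OF assms(4) this] show ?thesis
      by (simp add: frac_def)
  qed
  show "x \<in> {\<lfloor>x\<rfloor> - d<..<\<lfloor>x\<rfloor> + 1 + d}"
    by (rule frac_periodization_nhd[OF d(1)])
qed (use frac_periodization[of d g, OF assms(1-3)] in auto)

lemma continuous_on_frac_periodization:
  fixes g :: "real \<Rightarrow> real"
  assumes d: "0 < d" "d < 1"
    and "\<And>y. \<bar>y\<bar> < d \<Longrightarrow> g (y + 1) = g y"
    and "continuous_on UNIV g"
  shows "continuous_on UNIV (\<lambda>x. g (frac x))"
proof (rule continuous_at_imp_continuous_on, rule ballI)
  fix x :: real
  let ?U = "{\<lfloor>x\<rfloor> - d<..<\<lfloor>x\<rfloor> + 1 + d}"
  have "continuous_on ?U (\<lambda>y. g (y - \<lfloor>x\<rfloor>))"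
    by (intro continuous_on_compose2[OF assms(4)] continuous_intros) auto
  then have "continuous_on ?U (\<lambda>x. g (frac x))"
    using frac_periodization[of d g, OF assms(1-3)] by (subst continuous_on_cong[OF refl]) auto
  then show "isCont (\<lambda>x. g (frac x)) x"
    using frac_periodization_nhd[OF d(1)] by (simp add: continuous_on_eq_continuous_at)
qed

section \<open>The explicit density on one period cell\<close>

text \<open>The periodic solution of \<open>N'' = N - ion_density \<epsilon>\<close> is even about \<open>y = 1/2\<close> and is a multiple of
  \<open>cosh (y - 1/2)\<close> off the ions; the remaining terms of \<open>cell_density\<close> switch on quadratically inside
  the ions, and periodicity fixes the factor \<open>density_min\<close>.\<close>

definition density_min :: "real \<Rightarrow> real" where
  "density_min \<epsilon> = sinh (\<epsilon>/2) / (\<epsilon> * sinh (1/2))"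

definition cell_density :: "real \<Rightarrow> real \<Rightarrow> real" where
  "cell_density \<epsilon> y = density_min \<epsilon> * cosh (y - 1/2)
     + (1 - cosh (max 0 (\<epsilon>/2 - y))) / \<epsilon> + (1 - cosh (max 0 (y - (1 - \<epsilon>/2)))) / \<epsilon>"

definition cell_density_deriv :: "real \<Rightarrow> real \<Rightarrow> real" where
  "cell_density_deriv \<epsilon> y = density_min \<epsilon> * sinh (y - 1/2)
     + sinh (max 0 (\<epsilon>/2 - y)) / \<epsilon> - sinh (max 0 (y - (1 - \<epsilon>/2))) / \<epsilon>"

lemma has_real_derivative_cosh_max_zero [derivative_intros]:
  fixes g :: "real \<Rightarrow> real"
  assumes "(g has_real_derivative D) (at x within S)"
  shows "((\<lambda>x. cosh (max 0 (g x))) has_real_derivative sinh (max 0 (g x)) * D) (at x within S)"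
proof -
  have "(cosh has_real_derivative sinh s) (at s)" for s :: real
    by (auto intro!: derivative_eq_intros)
  then have "((\<lambda>s. cosh (max 0 s)) has_real_derivative sinh (max 0 s)) (at s)" for s :: real
    by (rule has_real_derivative_max_zero) simp
  from DERIV_chain2[OF this assms] show ?thesis .
qed

lemma has_real_derivative_cell_density: "(cell_density \<epsilon> has_real_derivative cell_density_deriv \<epsilon> y) (at y)"
proof (cases "\<epsilon> = 0")
  \<comment> \<open>Division by zero yields zero, so both functions vanish identically here.\<close>
  case True
  then show ?thesis
    by (auto simp: cell_density_def [abs_def] cell_density_deriv_def density_min_def)
next
  case False
  then show ?thesis
    unfolding cell_density_def [abs_def] cell_density_deriv_def
    by (auto intro!: derivative_eq_intros simp: field_simps)
qed

lemma continuous_on_cell_density: "continuous_on S (cell_density \<epsilon>)"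
  by (rule DERIV_continuous_on[OF has_field_derivative_at_within[OF has_real_derivative_cell_density]])

lemma continuous_on_cell_density_deriv: "continuous_on S (cell_density_deriv \<epsilon>)"
  unfolding cell_density_deriv_def [abs_def] divide_inverse
  by (intro continuous_intros)

context
  fixes \<epsilon> :: real
  assumes \<epsilon>: "0 < \<epsilon>" "\<epsilon> < 1"
begin

lemma density_min_pos: "density_min \<epsilon> > 0"
  using \<epsilon> by (simp add: density_min_def)

text \<open>Both \<open>y\<close> and \<open>y + 1\<close> lie where exactly one ion term is active.
  By the addition theorems the increments of the \<open>cosh (y - 1/2)\<close> term and of the ion
  terms are both multiples of \<open>2 * sinh y\<close>, and \<open>density_min\<close> is the ratio
  that makes them cancel.\<close>

lemma cell_density_periodic:
  assumes "\<bar>y\<bar> < \<epsilon>/2"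
  shows "cell_density \<epsilon> (y + 1) = cell_density \<epsilon> y"
proof -
  have maxs: "max 0 (\<epsilon>/2 - (y + 1)) = 0" "max 0 (\<epsilon>/2 - y) = \<epsilon>/2 - y"
    "max 0 (y + 1 - (1 - \<epsilon>/2)) = y + \<epsilon>/2" "max 0 (y - (1 - \<epsilon>/2)) = 0"
    "y + 1 - 1/2 = y + 1/2"
    using assms \<epsilon> by (auto simp: max_def)
  have "cosh (y + 1/2) - cosh (y - 1/2) = 2 * sinh y * sinh (1/2)"
    and "cosh (y + \<epsilon>/2) - cosh (\<epsilon>/2 - y) = 2 * sinh y * sinh (\<epsilon>/2)"
    by (simp_all only: cosh_add cosh_diff) (simp_all add: algebra_simps)
  then have "density_min \<epsilon> * (cosh (y + 1/2) - cosh (y - 1/2))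
      = (cosh (y + \<epsilon>/2) - cosh (\<epsilon>/2 - y)) / \<epsilon>"
    using \<epsilon> by (simp add: density_min_def field_simps)
  then show ?thesis
    unfolding cell_density_def maxs by (simp add: right_diff_distrib diff_divide_distrib)
qed

text \<open>The same cancellation, now with the common factor \<open>2 * cosh y\<close>.\<close>

lemma cell_density_deriv_periodic:
  assumes "\<bar>y\<bar> < \<epsilon>/2"
  shows "cell_density_deriv \<epsilon> (y + 1) = cell_density_deriv \<epsilon> y"
proof -
  have maxs: "max 0 (\<epsilon>/2 - (y + 1)) = 0" "max 0 (\<epsilon>/2 - y) = \<epsilon>/2 - y"
    "max 0 (y + 1 - (1 - \<epsilon>/2)) = y + \<epsilon>/2" "max 0 (y - (1 - \<epsilon>/2)) = 0"
    "y + 1 - 1/2 = y + 1/2"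
    using assms \<epsilon> by (auto simp: max_def)
  have "sinh (y + 1/2) - sinh (y - 1/2) = 2 * cosh y * sinh (1/2)"
    and "sinh (y + \<epsilon>/2) + sinh (\<epsilon>/2 - y) = 2 * cosh y * sinh (\<epsilon>/2)"
    by (simp_all only: sinh_add sinh_diff) (simp_all add: algebra_simps)
  then have "density_min \<epsilon> * (sinh (y + 1/2) - sinh (y - 1/2))
      = (sinh (y + \<epsilon>/2) + sinh (\<epsilon>/2 - y)) / \<epsilon>"
    using \<epsilon> by (simp add: density_min_def field_simps)
  then show ?thesis
    unfolding cell_density_deriv_def maxs by (simp add: right_diff_distrib add_divide_distrib)
qed

lemma cell_density_reflect: "cell_density \<epsilon> (1 - y) = cell_density \<epsilon> y"
proof -
  have "cosh (1 - y - 1/2) = cosh (y - 1/2)"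
    using cosh_minus[of "y - 1/2"] by simp
  then show ?thesis
    by (simp add: cell_density_def algebra_simps)
qed

text \<open>Between the ion layers the density is \<open>density_min \<epsilon>\<close> times a
  \<open>cosh\<close>, hence at least \<open>density_min \<epsilon>\<close>. Inside the left layer
  it decreases away from \<open>0\<close>, so its value at the edge \<open>\<epsilon>/2\<close> is a
  lower bound, and that value is again such a multiple.\<close>

lemma cell_density_ge_left:
  assumes "0 \<le> y" "y < 1 - \<epsilon>/2"
  shows "density_min \<epsilon> \<le> cell_density \<epsilon> y"
proof -
  have *: "density_min \<epsilon> \<le> density_min \<epsilon> * cosh z" for z
    using mult_left_mono[OF cosh_real_ge_1[of z]] density_min_pos by simp
  show ?thesis
  proof (cases "y \<le> \<epsilon>/2")
    case False
    then show ?thesis using * assms by (simp add: cell_density_def max_def)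
  next
    case True
    \<comment> \<open>In the layer the equation has the particular solution
      \<open>1/\<epsilon>\<close> and the density is even about \<open>0\<close>, so it must be
      \<open>1/\<epsilon> - a * cosh z\<close>; the addition theorems give this \<open>a\<close>,
      whose sign yields the monotonicity.\<close>
    define a where "a = sinh (1/2 - \<epsilon>/2) / (\<epsilon> * sinh (1/2))"
    have repr: "cell_density \<epsilon> z = 1/\<epsilon> - a * cosh z" if "z \<le> \<epsilon>/2" for z
    proof -
      have "sinh (\<epsilon>/2) * cosh (z - 1/2) - cosh (\<epsilon>/2 - z) * sinh (1/2)
          = - sinh (1/2 - \<epsilon>/2) * cosh z"
        by (simp only: sinh_diff cosh_diff) (simp add: algebra_simps)
      moreover have "density_min \<epsilon> * cosh (z - 1/2) - cosh (\<epsilon>/2 - z) / \<epsilon>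
          = (sinh (\<epsilon>/2) * cosh (z - 1/2) - cosh (\<epsilon>/2 - z) * sinh (1/2)) / (\<epsilon> * sinh (1/2))"
        using \<epsilon> by (simp add: density_min_def diff_divide_distrib)
      ultimately have "density_min \<epsilon> * cosh (z - 1/2) - cosh (\<epsilon>/2 - z) / \<epsilon> = - a * cosh z"
        by (simp add: a_def)
      then show ?thesis
        using that \<epsilon> by (simp add: cell_density_def max_def diff_divide_distrib)
    qed
    have "a \<ge> 0" using \<epsilon> by (simp add: a_def)
    moreover have "cosh y \<le> cosh (\<epsilon>/2)"
      using True assms by (simp add: cosh_real_nonneg_le_iff)
    ultimately have "cell_density \<epsilon> (\<epsilon>/2) \<le> cell_density \<epsilon> y"
      using repr[OF True] repr[of "\<epsilon>/2"] by (simp add: mult_left_mono)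
    moreover have "cell_density \<epsilon> (\<epsilon>/2) = density_min \<epsilon> * cosh (\<epsilon>/2 - 1/2)"
      using \<epsilon> by (simp add: cell_density_def max_def)
    ultimately show ?thesis using *[of "\<epsilon>/2 - 1/2"] by simp
  qed
qed

lemma cell_density_ge:
  assumes "y \<in> {0..1}"
  shows "density_min \<epsilon> \<le> cell_density \<epsilon> y"
  using cell_density_ge_left[of y] cell_density_ge_left[of "1 - y"] cell_density_reflect[of y] assms \<epsilon>
  by (cases "y < 1 - \<epsilon>/2") auto

text \<open>On each of the three intervals cut out by the ion edges the maxima resolve and the
  formula is smooth. The edges are left out because \<open>ion_density\<close> jumps there; a finite
  exceptional set is harmless for the integrals below.\<close>

lemma has_real_derivative_cell_density_deriv:
  assumes "0 < y" "y < 1" "y \<noteq> \<epsilon>/2" "y \<noteq> 1 - \<epsilon>/2"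
  shows "(cell_density_deriv \<epsilon> has_real_derivative cell_density \<epsilon> y - ion_density \<epsilon> y) (at y)"
proof -
  let ?b = "density_min \<epsilon>"
  consider "y < \<epsilon>/2" | "\<epsilon>/2 < y" "y < 1 - \<epsilon>/2" | "1 - \<epsilon>/2 < y"
    using assms by linarith
  then show ?thesis
  proof cases
    case 1
    have "((\<lambda>y. ?b * sinh (y - 1/2) + sinh (\<epsilon>/2 - y) / \<epsilon>) has_real_derivative
        cell_density \<epsilon> y - ion_density \<epsilon> y) (at y)"
      using 1 \<epsilon> assms
      by (auto intro!: derivative_eq_intros simp: cell_density_def ion_density_def max_def field_simps)
    then show ?thesis
      by (rule has_field_derivative_transform_within_open[where S="{..<\<epsilon>/2}"])
        (use 1 \<epsilon> in \<open>auto simp: cell_density_deriv_def max_def\<close>)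
  next
    case 2
    have "((\<lambda>y. ?b * sinh (y - 1/2)) has_real_derivative
        cell_density \<epsilon> y - ion_density \<epsilon> y) (at y)"
      using 2 \<epsilon> assms
      by (auto intro!: derivative_eq_intros simp: cell_density_def ion_density_def max_def field_simps)
    then show ?thesis
      by (rule has_field_derivative_transform_within_open[where S="{\<epsilon>/2<..<1 - \<epsilon>/2}"])
        (use 2 \<epsilon> in \<open>auto simp: cell_density_deriv_def max_def\<close>)
  next
    case 3
    have "((\<lambda>y. ?b * sinh (y - 1/2) - sinh (y - (1 - \<epsilon>/2)) / \<epsilon>) has_real_derivative
        cell_density \<epsilon> y - ion_density \<epsilon> y) (at y)"
      using 3 \<epsilon> assms
      by (auto intro!: derivative_eq_intros simp: cell_density_def ion_density_def max_def field_simps)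
    then show ?thesis
      by (rule has_field_derivative_transform_within_open[where S="{1 - \<epsilon>/2<..}"])
        (use 3 \<epsilon> in \<open>auto simp: cell_density_deriv_def max_def\<close>)
  qed
qed

section \<open>Total mass of the density and the field it generates\<close>

lemma has_integral_cell_density: "(cell_density \<epsilon> has_integral 1) {0..1}"
proof -
  \<comment> \<open>A primitive of \<open>N = N'' + ion_density \<epsilon>\<close>: the second
    summand is a continuous primitive of the ion density, rising from -1/2 to 1/2 over the
    cell.\<close>
  define R where "R y = cell_density_deriv \<epsilon> y + (max 0 (y - (1 - \<epsilon>/2)) - max 0 (\<epsilon>/2 - y)) / \<epsilon>" for y
  have "(R has_real_derivative cell_density \<epsilon> y) (at y)"
    if y: "0 < y" "y < 1" "y \<noteq> \<epsilon>/2" "y \<noteq> 1 - \<epsilon>/2" for y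
  proof -
    have "((\<lambda>y. (max 0 (y - (1 - \<epsilon>/2)) - max 0 (\<epsilon>/2 - y)) / \<epsilon>) has_real_derivative
        ion_density \<epsilon> y) (at y)"
    proof -
      consider "y < \<epsilon>/2" | "\<epsilon>/2 < y" "y < 1 - \<epsilon>/2" | "1 - \<epsilon>/2 < y"
        using y by linarith
      then show ?thesis
      proof cases
        case 1
        have "((\<lambda>y. - (\<epsilon>/2 - y) / \<epsilon>) has_real_derivative ion_density \<epsilon> y) (at y)"
          using 1 \<epsilon> y by (auto intro!: derivative_eq_intros simp: ion_density_def)
        then show ?thesis
          by (rule has_field_derivative_transform_within_open[where S="{..<\<epsilon>/2}"])
            (use 1 \<epsilon> in \<open>auto simp: max_def\<close>)
      next
        case 2
        have "((\<lambda>y. 0) has_real_derivative ion_density \<epsilon> y) (at y)"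
          using 2 \<epsilon> y by (auto simp: ion_density_def)
        then show ?thesis
          by (rule has_field_derivative_transform_within_open[where S="{\<epsilon>/2<..<1 - \<epsilon>/2}"])
            (use 2 \<epsilon> in \<open>auto simp: max_def\<close>)
      next
        case 3
        have "((\<lambda>y. (y - (1 - \<epsilon>/2)) / \<epsilon>) has_real_derivative ion_density \<epsilon> y) (at y)"
          using 3 \<epsilon> y by (auto intro!: derivative_eq_intros simp: ion_density_def)
        then show ?thesis
          by (rule has_field_derivative_transform_within_open[where S="{1 - \<epsilon>/2<..}"])
            (use 3 \<epsilon> in \<open>auto simp: max_def\<close>)
      qed
    qed
    from DERIV_add[OF has_real_derivative_cell_density_deriv[OF y] this] show ?thesis
      by (simp add: R_def [abs_def])
  qed
  moreover have "continuous_on {0..1} R"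
    unfolding R_def [abs_def] divide_inverse
    by (intro continuous_intros continuous_on_cell_density_deriv)
  ultimately have "(cell_density \<epsilon> has_integral R 1 - R 0) {0..1}"
    by (intro fundamental_theorem_of_calculus_interior_strong[where S="{\<epsilon>/2, 1 - \<epsilon>/2}"])
      (auto simp: has_real_derivative_iff_has_vector_derivative [symmetric])
  \<comment> \<open>Periodicity cancels the two values of \<open>N'\<close>; what remains is the
    total ion charge.\<close>
  moreover have "R 1 - R 0 = 1"
    using cell_density_deriv_periodic[of 0] \<epsilon> by (simp add: R_def max_def field_simps)
  ultimately show ?thesis by simp
qed

text \<open>Integration by parts: the integrand is \<open>- (y - c) * N''\<close> off the ion edges,
  with primitive \<open>N - (y - c) * N'\<close>.\<close>

lemma has_integral_cell_density_moment:
  fixes a b c :: real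
  assumes "0 \<le> a" "a \<le> b" "b \<le> 1"
  shows "((\<lambda>y. (y - c) * (ion_density \<epsilon> y - cell_density \<epsilon> y)) has_integral
    (cell_density \<epsilon> b - (b - c) * cell_density_deriv \<epsilon> b) - (cell_density \<epsilon> a - (a - c) * cell_density_deriv \<epsilon> a)) {a..b}"
proof (rule fundamental_theorem_of_calculus_interior_strong[where S="{\<epsilon>/2, 1 - \<epsilon>/2}"])
  show "continuous_on {a..b} (\<lambda>y. cell_density \<epsilon> y - (y - c) * cell_density_deriv \<epsilon> y)"
    by (intro continuous_intros continuous_on_cell_density continuous_on_cell_density_deriv)
  fix y assume "y \<in> {a<..<b} - {\<epsilon>/2, 1 - \<epsilon>/2}"
  with assms have "0 < y" "y < 1" "y \<noteq> \<epsilon>/2" "y \<noteq> 1 - \<epsilon>/2" by auto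
  then show "((\<lambda>y. cell_density \<epsilon> y - (y - c) * cell_density_deriv \<epsilon> y) has_vector_derivative
      (y - c) * (ion_density \<epsilon> y - cell_density \<epsilon> y)) (at y)"
    unfolding has_real_derivative_iff_has_vector_derivative [symmetric]
    by (auto intro!: derivative_eq_intros has_real_derivative_cell_density
        has_real_derivative_cell_density_deriv simp: algebra_simps)
qed (use assms in auto)

text \<open>The kernel is \<open>y - c\<close> with \<open>c = 0\<close> to the left of
  \<open>x\<close> and \<open>c = 1\<close> to the right. Adding the two moments, \<open>N x\<close>
  cancels, \<open>N 1 = N 0\<close>, and the remaining terms sum to \<open>- N' x\<close>.\<close>

lemma has_integral_K:
  assumes x: "x \<in> {0..1}"
  shows "((\<lambda>y. K x y * (ion_density \<epsilon> y - cell_density \<epsilon> y)) has_integral - cell_density_deriv \<epsilon> x) {0..1}"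
proof -
  let ?\<sigma> = "\<lambda>y. ion_density \<epsilon> y - cell_density \<epsilon> y"
  have "((\<lambda>y. K x y * ?\<sigma> y) has_integral
      cell_density \<epsilon> x - x * cell_density_deriv \<epsilon> x - cell_density \<epsilon> 0) {0..x}"
    by (rule has_integral_eq[rotated, of "\<lambda>y. (y - 0) * ?\<sigma> y"])
      (use has_integral_cell_density_moment[of 0 x 0] x in \<open>auto simp: K_def\<close>)
  moreover have "((\<lambda>y. K x y * ?\<sigma> y) has_integral
      cell_density \<epsilon> 1 - (cell_density \<epsilon> x - (x - 1) * cell_density_deriv \<epsilon> x)) {x..1}"
    \<comment> \<open>On the diagonal \<open>K x x = x\<close>, not \<open>x - 1\<close>; this
      single point is negligible.\<close>
    by (rule has_integral_spike[where S="{x}" and f="\<lambda>y. (y - 1) * ?\<sigma> y"])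
      (use has_integral_cell_density_moment[of x 1 1] x in \<open>auto simp: K_def\<close>)
  ultimately have "((\<lambda>y. K x y * ?\<sigma> y) has_integral
      (cell_density \<epsilon> x - x * cell_density_deriv \<epsilon> x - cell_density \<epsilon> 0)
      + (cell_density \<epsilon> 1 - (cell_density \<epsilon> x - (x - 1) * cell_density_deriv \<epsilon> x))) {0..1}"
    by (rule has_integral_combine[rotated 2]) (use x in auto)
  moreover have "cell_density \<epsilon> 1 = cell_density \<epsilon> 0"
    using cell_density_reflect[of 0] by simp
  ultimately show ?thesis by (simp add: algebra_simps)
qed

text \<open>Allows the gauge integral of \<open>has_integral_K\<close> to be read as the Lebesgue
  integral in \<open>electric_field\<close>. The integrand has jumps, so the argument is
  measurability and boundedness on \<open>{0..1}\<close>.\<close>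

lemma set_integrable_K:
  "set_integrable lborel {0..1} (\<lambda>y. K x y * (ion_density \<epsilon> y - cell_density \<epsilon> y))"
proof -
  have [measurable]: "cell_density \<epsilon> \<in> borel_measurable borel"
    by (intro borel_measurable_continuous_onI continuous_on_cell_density)
  have [measurable]: "K x \<in> borel_measurable borel"
    unfolding K_def [abs_def] by measurable
  have [measurable]: "ion_density \<epsilon> \<in> borel_measurable borel"
    unfolding ion_density_def [abs_def] by measurable
  have "compact (cell_density \<epsilon> ` {0..1})"
    by (intro compact_continuous_image continuous_on_cell_density) auto
  then obtain M where M: "\<And>y. y \<in> {0..1} \<Longrightarrow> \<bar>cell_density \<epsilon> y\<bar> \<le> M"
    by (metis compact_imp_bounded bounded_iff image_eqI real_norm_def)
  have "\<bar>ion_density \<epsilon> y - cell_density \<epsilon> y\<bar> \<le> 1/\<epsilon> + M" if "y \<in> {0..1}" for y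
  proof -
    have "\<bar>ion_density \<epsilon> y\<bar> \<le> 1/\<epsilon>"
      using \<epsilon> by (simp add: ion_density_def)
    then show ?thesis
      using M[OF that] by linarith
  qed
  then have "\<bar>K x y * (ion_density \<epsilon> y - cell_density \<epsilon> y)\<bar> \<le> 1 * (1/\<epsilon> + M)" if "y \<in> {0..1}" for y
    unfolding abs_mult using that by (intro mult_mono) (auto simp: K_def)
  then show ?thesis
    unfolding set_integrable_def
    by (intro integrableI_bounded_set[where A="{0..1}" and B="1/\<epsilon> + M"])
      (auto simp: indicator_def)
qed

section \<open>The equilibrium on the torus and its derivatives\<close>

definition spatial_density :: "real \<Rightarrow> real" where
  "spatial_density x = cell_density \<epsilon> (frac x)"

text \<open>At \<open>x = 1\<close> the fractional part is \<open>0\<close>, and reflection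
  identifies the two endpoint values.\<close>

lemma spatial_density_eq: "x \<in> {0..1} \<Longrightarrow> spatial_density x = cell_density \<epsilon> x"
  using cell_density_reflect[of 0] by (cases "x = 1") (auto simp: spatial_density_def frac_eq[THEN iffD2])

lemma frac_cell_density_deriv_eq: "x \<in> {0..1} \<Longrightarrow> cell_density_deriv \<epsilon> (frac x) = cell_density_deriv \<epsilon> x"
  using cell_density_deriv_periodic[of 0] \<epsilon> by (cases "x = 1") (auto simp: frac_eq[THEN iffD2])

lemma spatial_density_ge: "density_min \<epsilon> \<le> spatial_density x"
  unfolding spatial_density_def by (rule cell_density_ge) (auto simp: frac_lt_1 less_imp_le)

lemma has_real_derivative_spatial_density:
  "(spatial_density has_real_derivative cell_density_deriv \<epsilon> (frac x)) (at x)"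
  unfolding spatial_density_def [abs_def]
  using has_real_derivative_frac_periodization[of "\<epsilon>/2" "cell_density \<epsilon>" "cell_density_deriv \<epsilon>"]
    cell_density_periodic has_real_derivative_cell_density \<epsilon> by auto

lemma continuous_on_spatial_density: "continuous_on S spatial_density"
  by (rule DERIV_continuous_on[OF has_field_derivative_at_within[OF has_real_derivative_spatial_density]])

lemma continuous_on_spatial_density_deriv: "continuous_on UNIV (\<lambda>x. cell_density_deriv \<epsilon> (frac x))"
  using continuous_on_frac_periodization[of "\<epsilon>/2" "cell_density_deriv \<epsilon>"]
    cell_density_deriv_periodic continuous_on_cell_density_deriv \<epsilon> by auto

text \<open>The profile \<open>F\<close> of the introductory comment at energy
  \<open>v\<^sup>2/2 - n(x)\<close>, with \<open>m = density_min \<epsilon>\<close> and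
  \<open>n = spatial_density\<close>.\<close>

definition equilibrium :: "real \<Rightarrow> real \<Rightarrow> real" where
  "equilibrium x v = (pow32 (spatial_density x + density_min \<epsilon> - v\<^sup>2 / 2)
     - pow32 (spatial_density x - density_min \<epsilon> - v\<^sup>2 / 2)) / (4 * kinetic_moment * density_min \<epsilon>)"

text \<open>This is \<open>- F'\<close> at the same energy, the common factor of both phase-space
  derivatives.\<close>

definition equilibrium_slope :: "real \<Rightarrow> real \<Rightarrow> real" where
  "equilibrium_slope x v = 3 / 2 * (sqrt (max 0 (spatial_density x + density_min \<epsilon> - v\<^sup>2 / 2))
     - sqrt (max 0 (spatial_density x - density_min \<epsilon> - v\<^sup>2 / 2)))
     / (4 * kinetic_moment * density_min \<epsilon>)"

lemma equilibrium_nonneg: "0 \<le> equilibrium x v"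
  unfolding equilibrium_def using kinetic_moment_pos density_min_pos
  by (intro divide_nonneg_pos) (auto intro!: pow32_mono)

lemma integral_equilibrium: "(LINT v|lborel. equilibrium x v) = spatial_density x"
proof -
  let ?n = "spatial_density x" and ?m = "density_min \<epsilon>"
  have "(LINT v|lborel. equilibrium x v)
      = (kinetic_moment * (?n + ?m)\<^sup>2 - kinetic_moment * (?n - ?m)\<^sup>2) / (4 * kinetic_moment * ?m)"
    \<comment> \<open>The lower bound on the density makes \<open>?n - ?m\<close> nonnegative, so
      the scaling law applies to both terms.\<close>
    unfolding equilibrium_def using spatial_density_ge[of x] density_min_pos
    by (simp add: integrable_pow32_kinetic integral_pow32_kinetic)
  also have "\<dots> = ?n"
    using kinetic_moment_pos density_min_pos by (simp add: field_simps power2_eq_square)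
  finally show ?thesis .
qed

lemma equilibrium_deriv_x:
  "((\<lambda>y. equilibrium y v) has_real_derivative equilibrium_slope x v * cell_density_deriv \<epsilon> (frac x)) (at x)"
proof -
  have "((\<lambda>y. pow32 (spatial_density y + c - v\<^sup>2 / 2)) has_real_derivative
      3 / 2 * sqrt (max 0 (spatial_density x + c - v\<^sup>2 / 2)) * cell_density_deriv \<epsilon> (frac x)) (at x)" for c
    by (auto intro!: derivative_eq_intros has_real_derivative_spatial_density)
  from DERIV_cdivide[OF DERIV_diff[OF this[of "density_min \<epsilon>"] this[of "- density_min \<epsilon>"]]]
  show ?thesis
    by (simp add: equilibrium_def equilibrium_slope_def algebra_simps)
qed

lemma equilibrium_deriv_v:
  "((\<lambda>w. equilibrium x w) has_real_derivative - v * equilibrium_slope x v) (at v)"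
proof -
  have "((\<lambda>w. pow32 (c - w\<^sup>2 / 2)) has_real_derivative
      3 / 2 * sqrt (max 0 (c - v\<^sup>2 / 2)) * (- v)) (at v)" for c
    by (auto intro!: derivative_eq_intros)
  from DERIV_cdivide[OF DERIV_diff[OF this[of "spatial_density x + density_min \<epsilon>"]
        this[of "spatial_density x - density_min \<epsilon>"]]]
  show ?thesis
    by (simp add: equilibrium_def equilibrium_slope_def algebra_simps)
qed

lemma continuous_on_equilibrium: "continuous_on S (\<lambda>(x, v). equilibrium x v)"
  unfolding equilibrium_def case_prod_beta divide_inverse
  by (intro continuous_intros continuous_on_compose2[OF continuous_on_spatial_density[of UNIV]]) auto

lemma C1_equilibrium: "C1_phase_space_time (\<lambda>x v t. equilibrium x v)"
proof -
  have dx: "deriv (\<lambda>y. equilibrium y v) x = equilibrium_slope x v * cell_density_deriv \<epsilon> (frac x)" for x v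
    by (rule DERIV_imp_deriv[OF equilibrium_deriv_x])
  have dv: "deriv (\<lambda>w. equilibrium x w) v = - v * equilibrium_slope x v" for x v
    by (rule DERIV_imp_deriv[OF equilibrium_deriv_v])
  have slope: "continuous_on UNIV (\<lambda>z::real \<times> real \<times> real. equilibrium_slope (fst z) (fst (snd z)))"
    unfolding equilibrium_slope_def divide_inverse
    by (intro continuous_intros continuous_on_compose2[OF continuous_on_spatial_density[of UNIV]]) auto
  have "continuous_on UNIV (\<lambda>(x, v, t::real). deriv (\<lambda>y. equilibrium y v) x)"
    unfolding dx case_prod_beta
    by (intro continuous_on_mult slope continuous_on_compose2[OF continuous_on_spatial_density_deriv]
        continuous_intros) auto
  moreover have "continuous_on UNIV (\<lambda>(x, v, t::real). deriv (\<lambda>w. equilibrium x w) v)"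
    unfolding dv case_prod_beta by (intro continuous_intros slope)
  moreover have "(\<lambda>y. equilibrium y v) differentiable (at x)"
    "(\<lambda>w. equilibrium x w) differentiable (at v)" for x v
    using equilibrium_deriv_x equilibrium_deriv_v real_differentiable_def by blast+
  ultimately show ?thesis
    by (simp add: C1_phase_space_time_def)
qed

lemma electric_field_equilibrium:
  assumes "x \<in> {0..1}"
  shows "electric_field \<epsilon> (\<lambda>x v t. equilibrium x v) x t = - cell_density_deriv \<epsilon> x"
proof -
  have "electric_field \<epsilon> (\<lambda>x v t. equilibrium x v) x t
      = (LINT y:{0..1}|lborel. K x y * (ion_density \<epsilon> y - cell_density \<epsilon> y))"
    unfolding electric_field_def integral_equilibrium
    by (intro set_lebesgue_integral_cong) (auto simp: spatial_density_eq)
  also have "\<dots> = - cell_density_deriv \<epsilon> x"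
    using set_borel_integral_eq_integral(2)[OF set_integrable_K] has_integral_K[OF assms]
    by (simp add: integral_unique)
  finally show ?thesis .
qed

section \<open>Integrability, normalization and the Vlasov equation\<close>

lemma set_integrable_equilibrium:
  "set_integrable lborel ({0..1} \<times> UNIV) (\<lambda>(x, v). equilibrium x v)"
proof -
  have "compact (spatial_density ` {0..1})"
    by (intro compact_continuous_image continuous_on_spatial_density) auto
  then obtain M where M: "\<And>y. y \<in> {0..1} \<Longrightarrow> \<bar>spatial_density y\<bar> \<le> M"
    by (metis compact_imp_bounded bounded_iff image_eqI real_norm_def)
  \<comment> \<open>The velocity cutoff of \<open>le_half_square\<close> for the largest argument
    \<open>M + density_min \<epsilon>\<close>; beyond it both truncated powers vanish.\<close>
  define R where "R = 2 * (M + density_min \<epsilon>) + 1"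
  have "0 \<le> M" using M[of 0] by simp
  have zero: "equilibrium x v = 0" if "x \<in> {0..1}" "v \<notin> {-R..R}" for x v
  proof -
    from that have "R \<le> \<bar>v\<bar>" by auto
    then have "M + density_min \<epsilon> \<le> v\<^sup>2 / 2"
      using \<open>0 \<le> M\<close> density_min_pos by (intro le_half_square) (simp add: R_def)
    then show ?thesis
      using M[OF that(1)] density_min_pos by (simp add: equilibrium_def)
  qed
  have "integrable lborel (\<lambda>z. indicator ({0..1} \<times> {-R..R}) z *\<^sub>R (\<lambda>(x, v). equilibrium x v) z)"
    by (intro borel_integrable_compact compact_Times continuous_on_equilibrium) auto
  moreover have "indicator ({0..1} \<times> {-R..R}) z *\<^sub>R (\<lambda>(x, v). equilibrium x v) z
      = indicator ({0..1} \<times> UNIV) z *\<^sub>R (\<lambda>(x, v). equilibrium x v) z" for z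
    using zero by (cases z) (auto simp: indicator_def)
  ultimately show ?thesis
    by (simp only: set_integrable_def)
qed

text \<open>By Fubini the velocity integral comes first and leaves the cell density, whose integral
  is one.\<close>

lemma total_mass_equilibrium:
  "(LINT (x, v):{0..1} \<times> UNIV|lborel. equilibrium x v) = 1"
proof -
  let ?g = "\<lambda>z. indicator ({0..1} \<times> UNIV) z *\<^sub>R (\<lambda>(x, v). equilibrium x v) z"
  have "(LINT x|lborel. LINT v|lborel. ?g (x, v)) = integral\<^sup>L (lborel \<Otimes>\<^sub>M lborel) ?g"
    using set_integrable_equilibrium
    by (intro lborel_pair.integral_fst') (simp add: set_integrable_def lborel_prod)
  moreover have "(LINT v|lborel. ?g (x, v)) = indicator {0..1} x *\<^sub>R cell_density \<epsilon> x" for x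
    using spatial_density_eq[of x]
    by (cases "x \<in> {0..1}") (auto simp: indicator_def integral_equilibrium)
  moreover have "(LINT x:{0..1}|lborel. cell_density \<epsilon> x) = integral {0..1} (cell_density \<epsilon>)"
    by (intro set_borel_integral_eq_integral borel_integrable_atLeastAtMost')
      (rule continuous_on_cell_density)
  ultimately show ?thesis
    using has_integral_cell_density by (simp add: set_lebesgue_integral_def lborel_prod integral_unique)
qed

lemma vlasov_poisson_equilibrium: "vlasov_poisson_solution \<epsilon> (\<lambda>x v t. equilibrium x v)"
proof -
  have "equilibrium (x + 1) v = equilibrium x v" for x v
    by (simp add: equilibrium_def spatial_density_def frac_1_eq)
  then have "distribution_function (\<lambda>x v t. equilibrium x v)"
    using equilibrium_nonneg set_integrable_equilibrium total_mass_equilibrium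
    by (simp add: distribution_function_def)
  \<comment> \<open>With field \<open>- N'\<close> the transport terms are
    \<open>v * (slope * N')\<close> and \<open>- (- N') * (- v * slope)\<close>, which cancel; the
    time derivative is that of a constant.\<close>
  then show ?thesis
    using C1_equilibrium
    by (auto simp: vlasov_poisson_solution_def electric_field_equilibrium frac_cell_density_deriv_eq
        DERIV_imp_deriv[OF equilibrium_deriv_x] DERIV_imp_deriv[OF equilibrium_deriv_v])
qed

end

theorem theorem6p1:
  "\<exists>\<epsilon>\<^sub>0>0. \<forall>\<epsilon>::real. 0 < \<epsilon> \<and> \<epsilon> < 1 \<and> \<epsilon> < \<epsilon>\<^sub>0 \<longrightarrow>
     (\<exists>f. vlasov_poisson_solution \<epsilon> f \<and> stationary f)"
\<comment> \<open>The construction works for every \<open>\<epsilon>\<close> strictly between 0 and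
  1, so 1 serves as threshold.\<close>
proof (intro exI[of _ 1] conjI allI impI)
  fix \<epsilon> :: real
  assume "0 < \<epsilon> \<and> \<epsilon> < 1 \<and> \<epsilon> < 1"
  then show "\<exists>f. vlasov_poisson_solution \<epsilon> f \<and> stationary f"
    using vlasov_poisson_equilibrium[of \<epsilon>] by (auto simp: stationary_def)
qed simp

end
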